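(* Let $G$ be a Lévy group, let $X$ be a Polish space endowed with a $\sigma$-finite atomless locally finite Borel measure $\lambda$, and let $G$ act on $X$ by a continuous measure-preserving action. Then the action is trivial, i.e. the set of fixed points $\{x\in X : \forall g\in G,\ g\cdot x=x\}$ is conull.
   Context: A Borel measure $\lambda$ on a Polish space $X$ is locally finite if every $x\in X$ has an open neighborhood of finite $\lambda$-measure. A continuous measure-preserving action is a genuine group action $G\times X\to X$ which is a continuous map and such that each $g\in G$ preserves $\lambda$. A sequence $(X_n,d_n,m_n)$ of metric spaces with (Borel) probability measures is a Lévy family if whenever $A_n\subseteq X_n$ are measurable with $\liminf_n m_n(A_n)>0$, then for every $\varepsilon>0$ one has $\lim_n m_n((A_n)_\varepsilon)=1$, where $(A_n)_\varepsilon=\{x\in X_n: d_n(x,A_n)<\varepsilon\}$. A Polish group $G$ is a Lévy group if there is an increasing sequence $(K_n)$ of compact subgroups of $G$ with $\bigcup_n K_n$ dense in $G$ such that $(K_n,d_{\restriction K_n},m_n)$ is a Lévy family, where $m_n$ is the normalized Haar measure of $K_n$ and $d$ is a right-invariant compatible metric on $G$ (the choice of $d$ does not matter). *)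

theory Defs
  imports "HOL-Analysis.Analysis"
begin

text \<open>
  Groups are written additively, since the library's class of (not necessarily commutative)
  topological groups is \<^class>\<open>topological_group_add\<close>. A Polish group is a type of sort
  \<open>{topological_group_add, polish_space}\<close>. The complete metric \<^const>\<open>dist\<close> that comes with
  \<^class>\<open>polish_space\<close> only witnesses that the topology is Polish; it is not assumed to be
  invariant and plays no further role.
\<close>

definition subgroup_add :: "'g::group_add set \<Rightarrow> bool" where
  "subgroup_add H \<longleftrightarrow> 0 \<in> H \<and> (\<forall>g\<in>H. \<forall>h\<in>H. g + h \<in> H) \<and> (\<forall>g\<in>H. - g \<in> H)"

definition right_invariant_compatible_metric ::
    "('g::topological_group_add \<Rightarrow> 'g \<Rightarrow> real) \<Rightarrow> bool" where
  "right_invariant_compatible_metric d \<longleftrightarrow>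
     Metric_space UNIV d \<and>
     Metric_space.mtopology UNIV d = euclidean \<and>
     (\<forall>g h k. d (g + k) (h + k) = d g h)"

definition normalized_haar_measure ::
    "'g::topological_group_add set \<Rightarrow> 'g measure \<Rightarrow> bool" where
  "normalized_haar_measure K m \<longleftrightarrow>
     space m = K \<and>
     sets m = sets (restrict_space borel K) \<and>
     emeasure m K = 1 \<and>
     (\<forall>g\<in>K. \<forall>A\<in>sets m. emeasure m ((\<lambda>k. g + k) ` A) = emeasure m A)"

text \<open>
  The infimum is taken in \<^typ>\<open>ereal\<close>, so that points have infinite distance to the empty set.
\<close>

definition metric_nhd :: "'a set \<Rightarrow> ('a \<Rightarrow> 'a \<Rightarrow> real) \<Rightarrow> 'a set \<Rightarrow> real \<Rightarrow> 'a set" where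
  "metric_nhd X d A \<epsilon> = {x \<in> X. (INF a\<in>A. ereal (d x a)) < ereal \<epsilon>}"

definition levy_family ::
    "(nat \<Rightarrow> 'a set) \<Rightarrow> (nat \<Rightarrow> 'a \<Rightarrow> 'a \<Rightarrow> real) \<Rightarrow> (nat \<Rightarrow> 'a measure) \<Rightarrow> bool" where
  "levy_family X d m \<longleftrightarrow>
     (\<forall>n. Metric_space (X n) (d n) \<and>
          space (m n) = X n \<and>
          sets (m n) = sigma_sets (X n) {U. openin (Metric_space.mtopology (X n) (d n)) U} \<and>
          emeasure (m n) (X n) = 1) \<and>
     (\<forall>A. (\<forall>n. A n \<in> sets (m n)) \<and> liminf (\<lambda>n. emeasure (m n) (A n)) > 0 \<longrightarrow>
        (\<forall>\<epsilon>>0. (\<lambda>n. emeasure (m n) (metric_nhd (X n) (d n) (A n) \<epsilon>)) \<longlonglongrightarrow> 1))"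

definition levy_group :: "'g::{topological_group_add, polish_space} itself \<Rightarrow> bool" where
  "levy_group _ \<longleftrightarrow>
     (\<exists>(K :: nat \<Rightarrow> 'g set) m d.
        incseq K \<and>
        (\<forall>n. compact (K n) \<and> subgroup_add (K n)) \<and>
        closure (\<Union>n. K n) = UNIV \<and>
        (\<forall>n. normalized_haar_measure (K n) (m n)) \<and>
        right_invariant_compatible_metric d \<and>
        levy_family K (\<lambda>_. d) m)"

definition locally_finite_measure :: "'x::topological_space measure \<Rightarrow> bool" where
  "locally_finite_measure M \<longleftrightarrow> (\<forall>x. \<exists>U. open U \<and> x \<in> U \<and> emeasure M U < \<infinity>)"

definition is_atom :: "'x measure \<Rightarrow> 'x set \<Rightarrow> bool" where
  "is_atom M A \<longleftrightarrow>
     A \<in> sets M \<and> emeasure M A > 0 \<and>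
     (\<forall>B\<in>sets M. B \<subseteq> A \<and> emeasure M B < emeasure M A \<longrightarrow> emeasure M B = 0)"

definition atomless :: "'x measure \<Rightarrow> bool" where
  "atomless M \<longleftrightarrow> (\<nexists>A. is_atom M A)"

definition group_action_add :: "('g::group_add \<Rightarrow> 'x \<Rightarrow> 'x) \<Rightarrow> bool" where
  "group_action_add act \<longleftrightarrow>
     (\<forall>x. act 0 x = x) \<and> (\<forall>g h x. act (g + h) x = act g (act h x))"

definition measure_preserving_map :: "'x measure \<Rightarrow> ('x \<Rightarrow> 'x) \<Rightarrow> bool" where
  "measure_preserving_map M f \<longleftrightarrow>
     f \<in> measurable M M \<and>
     (\<forall>A\<in>sets M. emeasure M (f -` A \<inter> space M) = emeasure M A)"

definition continuous_measure_preserving_action ::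
    "'x::topological_space measure \<Rightarrow> ('g::topological_group_add \<Rightarrow> 'x \<Rightarrow> 'x) \<Rightarrow> bool" where
  "continuous_measure_preserving_action M act \<longleftrightarrow>
     group_action_add act \<and>
     continuous_on UNIV (\<lambda>(g, x). act g x) \<and>
     (\<forall>g. measure_preserving_map M (act g))"

definition fixed_points :: "('g \<Rightarrow> 'x \<Rightarrow> 'x) \<Rightarrow> 'x set" where
  "fixed_points act = {x. \<forall>g. act g x = x}"

end

theory Submission
  imports Defs "HOL-Probability.Probability_Measure"
begin

text \<open>
  Concentration of measure on the compact subgroups \<open>K n\<close> implies an expansion property: for large
  \<open>n\<close>, the \<open>\<epsilon>\<close>-neighborhood of any \<open>S \<subseteq> K n\<close> has measure close to 1 or much larger than the
  measure of \<open>S\<close>. Let \<open>U\<close> be an open set of finite measure and let \<open>A\<close> be the set of points that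
  remain in \<open>U\<close> under all group elements near the identity. For every point \<open>x\<close>, the set
  \<open>{g \<in> K n. g x \<in> U}\<close> contains a neighborhood of \<open>{g \<in> K n. g x \<in> A}\<close>. Integrating the expansion
  property over the space shows that up to a set of small measure, \<open>A\<close> lies in the \<open>K n\<close>-invariant
  set of points whose orbit is mostly in \<open>U\<close>, and this invariant set lies in \<open>U\<close>. Hence each
  \<open>k \<in> K n\<close> maps \<open>A\<close>, and by exhaustion also \<open>U\<close>, into \<open>U\<close> up to a null set. Applied to a countable
  base this shows that \<open>k\<close> fixes almost every point; density and continuity do the rest.
\<close>

section \<open>Tonelli for Borel sets, continuity and subgroups\<close>

text \<open>Second countability makes the Borel sigma-algebra of the product equal to the product
  sigma-algebra, so Tonelli applies to any Borel relation. All averaging arguments below are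
  instances.\<close>

lemma nn_integral_emeasure_swap:
  fixes M :: "'a::second_countable_topology measure" and N :: "'b::second_countable_topology measure"
  assumes "sigma_finite_measure M" "sigma_finite_measure N"
    and sM: "sets M = sets borel" and sN: "sets N = sets borel"
    and A: "{(x, y). P x y} \<in> sets borel"
  shows "(\<integral>\<^sup>+x. emeasure N {y. P x y} \<partial>M) = (\<integral>\<^sup>+y. emeasure M {x. P x y} \<partial>N)"
proof -
  interpret M: sigma_finite_measure M by fact
  interpret N: sigma_finite_measure N by fact
  interpret pair_sigma_finite M N ..
  have A': "{(x, y). P x y} \<in> sets (M \<Otimes>\<^sub>M N)"
    using A unfolding sets_pair_measure_cong[OF sM sN] borel_prod .
  have "(\<integral>\<^sup>+x. emeasure N {y. P x y} \<partial>M) = emeasure (M \<Otimes>\<^sub>M N) {(x, y). P x y}"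
    by (subst N.emeasure_pair_measure_alt[OF A']) (simp add: vimage_def)
  also have "\<dots> = (\<integral>\<^sup>+y. emeasure M {x. P x y} \<partial>N)"
    by (subst emeasure_pair_measure_alt2[OF A']) (simp add: vimage_def)
  finally show ?thesis .
qed

lemma measurable_emeasure_section:
  fixes M :: "'a::second_countable_topology measure" and N :: "'b::second_countable_topology measure"
  assumes "sigma_finite_measure N"
    and sM: "sets M = sets borel" and sN: "sets N = sets borel"
    and A: "{(x, y). P x y} \<in> sets borel"
  shows "(\<lambda>x. emeasure N {y. P x y}) \<in> borel_measurable M"
proof -
  interpret N: sigma_finite_measure N by fact
  have A': "{(x, y). P x y} \<in> sets (M \<Otimes>\<^sub>M N)"
    using A unfolding sets_pair_measure_cong[OF sM sN] borel_prod .
  show ?thesis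
    using N.measurable_emeasure_Pair[OF A'] by (simp add: vimage_def)
qed

lemma sets_borel_Collect_continuous:
  fixes f :: "'a::topological_space \<Rightarrow> 'b::topological_space"
  assumes "continuous_on UNIV f" "B \<in> sets borel"
  shows "{x. f x \<in> B} \<in> sets borel"
  using measurable_sets[OF borel_measurable_continuous_onI[OF assms(1)] assms(2)]
  by (simp add: vimage_def)

lemma subgroup_add_minus:
  assumes "subgroup_add K" "h \<in> K"
  shows "- h \<in> K" "g - h \<in> K \<longleftrightarrow> g \<in> K" "g + h \<in> K \<longleftrightarrow> g \<in> K"
proof -
  have *: "g + h \<in> K" if "g \<in> K" "h \<in> K" for g h
    using assms that by (auto simp: subgroup_add_def)
  have **: "- h \<in> K" if "h \<in> K" for h
    using assms that by (auto simp: subgroup_add_def)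
  show "- h \<in> K" using ** assms by auto
  show "g - h \<in> K \<longleftrightarrow> g \<in> K"
    using *[of g "- h"] *[of "g - h" h] ** assms(2) by auto
  show "g + h \<in> K \<longleftrightarrow> g \<in> K"
    using *[of g h] *[of "g + h" "- h"] ** assms(2) by (auto simp: add.assoc)
qed

section \<open>Haar probability measures and expansion of neighborhoods\<close>

text \<open>
  Haar measures are extended by zero to Borel measures on the whole group, so that all
  product measures live on Borel sigma-algebras.
\<close>

locale haar_prob = prob_space \<mu>
  for \<mu> :: "'g::{topological_group_add, second_countable_topology} measure" +
  fixes K :: "'g set"
  assumes sets_mu: "sets \<mu> = sets borel"
    and subgroup: "subgroup_add K"
    and AE_K: "AE g in \<mu>. g \<in> K"
    and left_invariant: "\<And>g B. g \<in> K \<Longrightarrow> B \<in> sets borel \<Longrightarrow>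
           emeasure \<mu> {h. g + h \<in> B} = emeasure \<mu> B"
begin

lemma space_mu [simp]: "space \<mu> = UNIV"
  using sets_eq_imp_space_eq[OF sets_mu] by simp

text \<open>For fixed \<open>g\<close> in \<open>K\<close> the section
  \<open>{h. - g + h \<in> B}\<close> is a left translate of \<open>B\<close>; for fixed
  \<open>h\<close> in \<open>K\<close> the section in \<open>g\<close> is a left translate of the
  inverse of \<open>B\<close>. Integrating both over the probability measure and swapping compares
  the two measures.\<close>

lemma inversion_invariant:
  assumes B: "B \<in> sets borel"
  shows "emeasure \<mu> {h. - h \<in> B} = emeasure \<mu> B"
proof -
  have B': "{h. - h \<in> B} \<in> sets borel"
    by (intro sets_borel_Collect_continuous continuous_intros B)
  have "{z. - fst z + snd z \<in> B} \<in> sets (borel :: ('g \<times> 'g) measure)"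
    by (intro sets_borel_Collect_continuous continuous_intros B)
  moreover have "{(g, h). - g + h \<in> B} = {z. - fst z + snd z \<in> B}" by auto
  ultimately have m: "{(g, h). - g + h \<in> B} \<in> sets (borel :: ('g \<times> 'g) measure)"
    by simp
  have "emeasure \<mu> B = (\<integral>\<^sup>+g. emeasure \<mu> B \<partial>\<mu>)"
    using emeasure_space_1 by simp
  also have "\<dots> = (\<integral>\<^sup>+g. emeasure \<mu> {h. - g + h \<in> B} \<partial>\<mu>)"
    using AE_K by (intro nn_integral_cong_AE, eventually_elim)
      (use left_invariant B subgroup_add_minus[OF subgroup] in auto)
  also have "\<dots> = (\<integral>\<^sup>+h. emeasure \<mu> {g. - g + h \<in> B} \<partial>\<mu>)"
    by (intro nn_integral_emeasure_swap sets_mu m sigma_finite_measure_axioms)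
  also have "\<dots> = (\<integral>\<^sup>+h. emeasure \<mu> {h. - h \<in> B} \<partial>\<mu>)"
  proof (intro nn_integral_cong_AE, use AE_K in eventually_elim)
    fix h assume "h \<in> K"
    then show "emeasure \<mu> {g. - g + h \<in> B} = emeasure \<mu> {h. - h \<in> B}"
      using left_invariant[of "- h", OF _ B'] subgroup_add_minus[OF subgroup]
      by (simp add: minus_add)
  qed
  also have "\<dots> = emeasure \<mu> {h. - h \<in> B}"
    using emeasure_space_1 by simp
  finally show ?thesis ..
qed

text \<open>Inversion turns right translation into left translation. Right translates are the
  relevant ones because the metric is right-invariant.\<close>

lemma right_invariant:
  assumes B: "B \<in> sets borel" and h: "h \<in> K"
  shows "emeasure \<mu> {g. g + h \<in> B} = emeasure \<mu> B"
proof -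
  have B': "{h. - h \<in> B} \<in> sets borel"
    by (intro sets_borel_Collect_continuous continuous_intros B)
  have "{g. g + h \<in> B} \<in> sets borel"
    by (intro sets_borel_Collect_continuous continuous_intros B)
  from inversion_invariant[OF this]
  have "emeasure \<mu> {g. g + h \<in> B} = emeasure \<mu> {g. - h + g \<in> {h. - h \<in> B}}"
    by (simp add: minus_add)
  also have "\<dots> = emeasure \<mu> B"
    using left_invariant[OF _ B', of "- h"] h subgroup_add_minus[OF subgroup]
      inversion_invariant[OF B] by simp
  finally show ?thesis .
qed

lemma prob_right_translate:
  assumes "B \<in> sets borel" "h \<in> K"
  shows "prob {g. g - h \<in> B} = prob B"
  using right_invariant[of B "- h"] assms subgroup_add_minus[OF subgroup] by (simp add: measure_def)

text \<open>First moment method: for random \<open>g\<close>, the right translate of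
  \<open>S\<close> by \<open>g\<close> meets \<open>W\<close> in expected measure exactly
  \<open>prob S * prob W\<close>, so some \<open>g\<close> attains at least the mean.\<close>

lemma exists_translate_large_inter:
  assumes S: "S \<in> sets borel" and W: "W \<in> sets borel"
  shows "\<exists>g\<in>K. prob S * prob W \<le> prob ({k. k - g \<in> S} \<inter> W)"
proof (rule ccontr)
  assume "\<not> ?thesis"
  then have less: "prob ({k. k - g \<in> S} \<inter> W) < prob S * prob W" if "g \<in> K" for g
    using that by force
  have "{z. snd z - fst z \<in> S} \<inter> {z. snd z \<in> W} \<in> sets (borel :: ('g \<times> 'g) measure)"
    by (intro sets.Int sets_borel_Collect_continuous continuous_intros S W)
  moreover have "{(g, k). k - g \<in> S \<and> k \<in> W} =
      {z. snd z - fst z \<in> S} \<inter> {z. snd z \<in> W}" by auto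
  ultimately have m: "{(g, k). k - g \<in> S \<and> k \<in> W} \<in> sets (borel :: ('g \<times> 'g) measure)"
    by simp
  have W': "W \<in> sets \<mu>" using W sets_mu by simp
  \<comment> \<open>As a set of elements \<open>g\<close>, this section is the inverse of a left
    translate of \<open>S\<close>.\<close>
  have S_section: "emeasure \<mu> {g. k - g \<in> S} = emeasure \<mu> S" if "k \<in> K" for k
  proof -
    have "{g. k + g \<in> S} \<in> sets borel"
      by (intro sets_borel_Collect_continuous continuous_intros S)
    from inversion_invariant[OF this] left_invariant[OF that S] show ?thesis by simp
  qed
  have *: "(\<integral>\<^sup>+g. emeasure \<mu> {k. k - g \<in> S \<and> k \<in> W} \<partial>\<mu>) = ennreal (prob S * prob W)"
  proof -
    have "(\<integral>\<^sup>+g. emeasure \<mu> {k. k - g \<in> S \<and> k \<in> W} \<partial>\<mu>)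
        = (\<integral>\<^sup>+k. emeasure \<mu> {g. k - g \<in> S \<and> k \<in> W} \<partial>\<mu>)"
      by (intro nn_integral_emeasure_swap sets_mu m sigma_finite_measure_axioms)
    also have "\<dots> = (\<integral>\<^sup>+k. emeasure \<mu> S * indicator W k \<partial>\<mu>)"
      using AE_K
      by (intro nn_integral_cong_AE, eventually_elim) (auto simp: S_section indicator_def)
    also have "\<dots> = emeasure \<mu> S * emeasure \<mu> W"
      using W' by (simp add: nn_integral_cmult_indicator)
    finally show ?thesis
      by (simp add: emeasure_eq_measure ennreal_mult')
  qed
  have Int_conj: "{k. k - g \<in> S} \<inter> W = {k. k - g \<in> S \<and> k \<in> W}" for g by auto
  have fm: "(\<lambda>g. prob ({k. k - g \<in> S} \<inter> W)) \<in> borel_measurable \<mu>"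
  proof -
    have "(\<lambda>g. emeasure \<mu> {k. k - g \<in> S \<and> k \<in> W}) \<in> borel_measurable \<mu>"
      by (intro measurable_emeasure_section sets_mu m sigma_finite_measure_axioms)
    then have "(\<lambda>g. enn2real (emeasure \<mu> {k. k - g \<in> S \<and> k \<in> W})) \<in> borel_measurable \<mu>"
      by measurable
    then show ?thesis by (simp add: measure_def Int_conj)
  qed
  have int: "integrable \<mu> (\<lambda>g. prob ({k. k - g \<in> S} \<inter> W))"
    by (rule integrable_const_bound[of _ 1]) (auto simp: fm)
  have "(\<integral>g. prob ({k. k - g \<in> S} \<inter> W) \<partial>\<mu>) = prob S * prob W"
    using * fm by (subst integral_eq_nn_integral)
      (auto simp: emeasure_eq_measure[symmetric] Int_conj)
  moreover have "(\<integral>g. prob ({k. k - g \<in> S} \<inter> W) \<partial>\<mu>) < prob S * prob W"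
  proof -
    have "AE g in \<mu>. prob ({k. k - g \<in> S} \<inter> W) < prob S * prob W"
      using AE_K by eventually_elim (rule less)
    from integral_less_AE_space[OF int _ this] show ?thesis
      using emeasure_space_1 prob_space by simp
  qed
  ultimately show False by simp
qed

text \<open>Greedy choice: as long as the union has measure below 1/2, its complement has measure
  above 1/2, and some further translate adds at least \<open>prob S / 2\<close>.\<close>

lemma exists_translates_large_union:
  assumes S: "S \<in> sets borel"
  shows "\<exists>F. finite F \<and> F \<subseteq> K \<and> card F \<le> N \<and>
           min (1/2) (real N * prob S / 2) \<le> prob (\<Union>g\<in>F. {k. k - g \<in> S})"
proof (induction N)
  case 0
  then show ?case by (auto intro!: exI[of _ "{}"])
next
  case (Suc N)
  then obtain F where F: "finite F" "F \<subseteq> K" "card F \<le> N"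
    and le: "min (1/2) (real N * prob S / 2) \<le> prob (\<Union>g\<in>F. {k. k - g \<in> S})"
    by blast
  define U where "U = (\<Union>g\<in>F. {k. k - g \<in> S})"
  have St: "{k. k - g \<in> S} \<in> sets borel" for g
    by (intro sets_borel_Collect_continuous continuous_intros S)
  then have U: "U \<in> sets borel"
    unfolding U_def using F(1) by (intro sets.finite_UN) auto
  show ?case
  proof (cases "1/2 \<le> prob U")
    case True
    then show ?thesis using F by (intro exI[of _ F]) (auto simp: U_def)
  next
    case False
    from exists_translate_large_inter[OF S, of "- U"] U obtain g where
      g: "g \<in> K" "prob S * prob (- U) \<le> prob ({k. k - g \<in> S} \<inter> - U)" by auto
    have "prob (- U) = 1 - prob U"
      using prob_compl[of U] U sets_mu by (simp add: Compl_eq_Diff_UNIV)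
    with False have "prob S * (1/2) \<le> prob S * prob (- U)"
      by (intro mult_left_mono) auto
    with g have "prob S / 2 \<le> prob ({k. k - g \<in> S} \<inter> - U)" by simp
    moreover have "prob (U \<union> ({k. k - g \<in> S} \<inter> - U)) = prob U + prob ({k. k - g \<in> S} \<inter> - U)"
      using U St sets_mu by (intro finite_measure_Union) auto
    moreover have "U \<union> ({k. k - g \<in> S} \<inter> - U) = (\<Union>g\<in>insert g F. {k. k - g \<in> S})"
      by (auto simp: U_def)
    moreover have "real N * prob S / 2 \<le> prob U"
      using False le by (auto simp: U_def min_def split: if_splits)
    ultimately have "real (Suc N) * prob S / 2 \<le> prob (\<Union>g\<in>insert g F. {k. k - g \<in> S})"
      by (simp add: field_simps)
    moreover have "card (insert g F) \<le> Suc N" "finite (insert g F)" "insert g F \<subseteq> K"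
      using F g(1) card_insert_le_m1[of "Suc N" F g] by auto
    ultimately show ?thesis by (intro exI[of _ "insert g F"]) auto
  qed
qed

text \<open>
  Concentration only speaks about sets of measure bounded below. A small set \<open>S\<close> is treated by
  taking the union of about \<open>1 / prob S\<close> right translates of it: this has measure bounded below,
  while its neighborhood has measure at most \<open>prob S' / prob S\<close>.
\<close>

lemma neighborhood_expansion:
  fixes L :: real
  assumes near: "\<And>g h k. near (g + k) (h + k) \<longleftrightarrow> near g h"
    and concentration: "\<And>S S'. S \<in> sets borel \<Longrightarrow> S' \<in> sets borel \<Longrightarrow>
        (\<And>g h. g \<in> K \<Longrightarrow> h \<in> K \<Longrightarrow> h \<in> S \<Longrightarrow> near g h \<Longrightarrow> g \<in> S') \<Longrightarrow>
        1 / (8 * L) \<le> prob S \<Longrightarrow> 1 - 1 / L \<le> prob S'"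
    and L: "3 \<le> L" and S: "S \<in> sets borel" and S': "S' \<in> sets borel"
    and nhd: "\<And>g h. g \<in> K \<Longrightarrow> h \<in> K \<Longrightarrow> h \<in> S \<Longrightarrow> near g h \<Longrightarrow> g \<in> S'"
  shows "1 - 1 / L \<le> prob S' \<or> L * prob S \<le> prob S'"
proof (rule ccontr)
  assume "\<not> ?thesis"
  then have not_large: "prob S' < 1 - 1 / L" and less: "prob S' < L * prob S" by auto
  have small: "prob S < 1 / (8 * L)"
    using concentration[OF S S' nhd] not_large by force
  have "0 < L * prob S" using less measure_nonneg[of \<mu> S'] by linarith
  then have pos: "0 < prob S" using L by (simp add: zero_less_mult_iff)
  \<comment> \<open>The upper bound on \<open>N\<close> will give
    \<open>N * L * prob S \<le> 1/2\<close>. Smallness of \<open>S\<close> makes the unrounded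
    quotient exceed 4, so rounding loses at most half of it and \<open>N * prob S / 2\<close> is
    still at least \<open>1 / (8 * L)\<close>, the threshold for concentration.\<close>
  define N where "N = nat \<lfloor>1 / (2 * L * prob S)\<rfloor>"
  have q: "4 < 1 / (2 * L * prob S)"
    using small pos L by (simp add: field_simps)
  have N: "real N \<le> 1 / (2 * L * prob S)" "1 / (2 * L * prob S) - 1 \<le> real N"
    using q unfolding N_def by linarith+
  obtain F where F: "finite F" "F \<subseteq> K" "card F \<le> N"
    and le: "min (1/2) (real N * prob S / 2) \<le> prob (\<Union>g\<in>F. {k. k - g \<in> S})"
    using exists_translates_large_union[OF S] by blast
  have "1 / (4 * L * prob S) \<le> real N"
    using N(2) q by (simp add: field_simps)
  then have "1 / (8 * L) \<le> real N * prob S / 2"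
    using pos L by (simp add: field_simps)
  moreover have "1 / (8 * L) \<le> 1/2" using L by (simp add: field_simps)
  ultimately have ge: "1 / (8 * L) \<le> prob (\<Union>g\<in>F. {k. k - g \<in> S})"
    using le by linarith
  have meas: "{k. k - g \<in> B} \<in> sets borel" if "B \<in> sets borel" for g :: 'g and B
    by (intro sets_borel_Collect_continuous continuous_intros that)
  \<comment> \<open>Right-invariance of \<open>near\<close> lets the same translates of
    \<open>S'\<close> absorb the neighborhood of the union of translates of \<open>S\<close>.
    Counting then bounds the measure of their union by 1/2, which contradicts
    \<open>3 \<le> L\<close>.\<close>
  have "1 - 1 / L \<le> prob (\<Union>g\<in>F. {k. k - g \<in> S'})"
  proof (rule concentration[OF _ _ _ ge])
    fix k h assume kh: "k \<in> K" "h \<in> K" "h \<in> (\<Union>g\<in>F. {k. k - g \<in> S})" "near k h"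
    then obtain g where g: "g \<in> F" "h - g \<in> S" by auto
    have "near (k - g) (h - g)" using near[of k "- g" h] kh(4) by simp
    then have "k - g \<in> S'"
      using kh(1,2) g F(2) subgroup_add_minus(2)[OF subgroup] by (intro nhd[of "k - g" "h - g"]) auto
    then show "k \<in> (\<Union>g\<in>F. {k. k - g \<in> S'})" using g by auto
  qed (use F(1) S S' meas in \<open>auto intro!: sets.finite_UN\<close>)
  also have "\<dots> \<le> (\<Sum>g\<in>F. prob {k. k - g \<in> S'})"
    using F(1) S' meas sets_mu by (intro finite_measure_subadditive_finite) auto
  also have "\<dots> = (\<Sum>g\<in>F. prob S')"
    using F(2) S' by (intro sum.cong prob_right_translate) auto
  also have "\<dots> = real (card F) * prob S'" by simp
  also have "\<dots> \<le> real N * (L * prob S)"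
    using F(3) less by (intro mult_mono) auto
  also have "\<dots> \<le> 1/2"
    using mult_right_mono[OF N(1), of "L * prob S"] pos L by (simp add: field_simps)
  finally have "1 - 1 / L \<le> 1 / 2" .
  then show False using L by (simp add: field_simps)
qed

end

section \<open>Averaging a measure-preserving action over a subgroup\<close>

lemma continuous_action:
  assumes "continuous_measure_preserving_action M act"
  shows "continuous_on UNIV (\<lambda>z. act (fst z) (snd z))"
    and "continuous_on UNIV (act g)"
    and "continuous_on UNIV (\<lambda>g. act g x)"
proof -
  show cont: "continuous_on UNIV (\<lambda>z. act (fst z) (snd z))"
    using assms by (simp add: continuous_measure_preserving_action_def case_prod_beta')
  show "continuous_on UNIV (act g)"
    using continuous_on_compose2[OF cont, of UNIV "\<lambda>x. (g, x)"] by (simp add: continuous_intros)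
  show "continuous_on UNIV (\<lambda>g. act g x)"
    using continuous_on_compose2[OF cont, of UNIV "\<lambda>g. (g, x)"] by (simp add: continuous_intros)
qed

locale haar_action = haar_prob \<mu> K + M: sigma_finite_measure M
  for \<mu> :: "'g::{topological_group_add, second_countable_topology} measure" and K
    and M :: "'x::second_countable_topology measure" +
  fixes act :: "'g \<Rightarrow> 'x \<Rightarrow> 'x"
  assumes sets_M: "sets M = sets borel"
    and action: "continuous_measure_preserving_action M act"
begin

lemma space_M [simp]: "space M = UNIV"
  using sets_eq_imp_space_eq[OF sets_M] by simp

lemma act_add: "act (g + h) x = act g (act h x)"
  using action by (simp add: continuous_measure_preserving_action_def group_action_add_def)

lemmas continuous_act = continuous_action(1)[OF action]

lemma emeasure_act:
  "A \<in> sets borel \<Longrightarrow> emeasure M {x. act g x \<in> A} = emeasure M A"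
  using action sets_M
  by (auto simp: continuous_measure_preserving_action_def measure_preserving_map_def vimage_def)

lemma sets_act_pair:
  assumes "A \<in> sets borel"
  shows "{(g, x). act g x \<in> A} \<in> sets borel"
proof -
  have "{(g, x). act g x \<in> A} = {z. act (fst z) (snd z) \<in> A}" by auto
  then show ?thesis using sets_borel_Collect_continuous[OF continuous_act assms] by simp
qed

lemma sets_act:
  assumes "A \<in> sets borel"
  shows "{x. act g x \<in> A} \<in> sets borel" "{g. act g x \<in> A} \<in> sets borel"
  by (intro sets_borel_Collect_continuous continuous_action(2,3)[OF action] assms)+

lemma sets_act_pair':
  assumes "A \<in> sets borel"
  shows "{(x, g). act g x \<in> A} \<in> sets borel"
proof -
  have "continuous_on UNIV (\<lambda>z. act (snd z) (fst z))"
    using continuous_on_compose2[OF continuous_act, of UNIV "\<lambda>z. (snd z, fst z)"]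
    by (simp add: continuous_intros)
  moreover have "{(x, g). act g x \<in> A} = {z. act (snd z) (fst z) \<in> A}" by auto
  ultimately show ?thesis using sets_borel_Collect_continuous[OF _ assms] by simp
qed

lemma measurable_orbit_emeasure:
  assumes "A \<in> sets borel"
  shows "(\<lambda>x. emeasure \<mu> {g. act g x \<in> A}) \<in> borel_measurable M"
  by (intro measurable_emeasure_section sets_act_pair' sets_mu sets_M assms
      sigma_finite_measure_axioms)

text \<open>Each \<open>g\<close> in \<open>K\<close> preserves both \<open>M\<close> and
  \<open>Q\<close>, so \<open>A \<inter> Q\<close> has the same measure as its preimage under
  \<open>g\<close>. Averaging over \<open>g\<close> and swapping expresses this measure through the
  fraction of each orbit that lies in \<open>A\<close>.\<close>

lemma emeasure_inter_invariant:
  assumes A: "A \<in> sets borel" and Q: "Q \<in> sets borel"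
    and inv: "\<And>k x. k \<in> K \<Longrightarrow> act k x \<in> Q \<longleftrightarrow> x \<in> Q"
  shows "emeasure M (A \<inter> Q) = (\<integral>\<^sup>+x. emeasure \<mu> {g. act g x \<in> A} * indicator Q x \<partial>M)"
proof -
  have "{z. snd z \<in> Q} \<in> sets (borel :: ('g \<times> 'x) measure)"
    by (intro sets_borel_Collect_continuous continuous_intros Q)
  moreover have "{(g, x). act g x \<in> A \<and> x \<in> Q} = {(g, x). act g x \<in> A} \<inter> {z. snd z \<in> Q}"
    by auto
  ultimately have m: "{(g, x). act g x \<in> A \<and> x \<in> Q} \<in> sets borel"
    using sets_act_pair[OF A] by simp
  have "emeasure M (A \<inter> Q) = (\<integral>\<^sup>+g. emeasure M (A \<inter> Q) \<partial>\<mu>)"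
    using emeasure_space_1 by simp
  also have "\<dots> = (\<integral>\<^sup>+g. emeasure M {x. act g x \<in> A \<and> x \<in> Q} \<partial>\<mu>)"
  proof (intro nn_integral_cong_AE, use AE_K in eventually_elim)
    fix g assume "g \<in> K"
    then show "emeasure M (A \<inter> Q) = emeasure M {x. act g x \<in> A \<and> x \<in> Q}"
      using emeasure_act[of "A \<inter> Q" g] inv[of g] A Q by simp
  qed
  also have "\<dots> = (\<integral>\<^sup>+x. emeasure \<mu> {g. act g x \<in> A \<and> x \<in> Q} \<partial>M)"
    by (intro nn_integral_emeasure_swap sets_mu sets_M m sigma_finite_measure_axioms
        M.sigma_finite_measure_axioms)
  also have "\<dots> = (\<integral>\<^sup>+x. emeasure \<mu> {g. act g x \<in> A} * indicator Q x \<partial>M)"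
    by (intro nn_integral_cong) (auto simp: indicator_def)
  finally show ?thesis .
qed

lemma emeasure_displaced_le:
  fixes L :: real
  assumes A: "A \<in> sets borel" and U: "U \<in> sets borel" and L: "2 \<le> L" and k: "k \<in> K"
    and expansion: "\<And>x. 1 - 1 / L \<le> prob {g. act g x \<in> U} \<or>
        L * prob {g. act g x \<in> A} \<le> prob {g. act g x \<in> U}"
  shows "ennreal L * emeasure M {x. act k x \<in> A \<and> x \<notin> U} \<le> 3 * emeasure M U"
proof -
  \<comment> \<open>The points whose orbit lies mostly in \<open>U\<close>. Moving \<open>x\<close>
    by an element of \<open>K\<close> right-translates its set of visiting times, so
    right-invariance makes \<open>P\<close> invariant under \<open>K\<close>.\<close>
  define P where "P = {x. ennreal (1 - 1 / L) \<le> emeasure \<mu> {g. act g x \<in> U}}"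
  have P_iff: "x \<in> P \<longleftrightarrow> 1 - 1 / L \<le> prob {g. act g x \<in> U}" for x
    unfolding P_def by (simp add: emeasure_eq_measure)
  have "{x \<in> space M. ennreal (1 - 1 / L) \<le> emeasure \<mu> {g. act g x \<in> U}} \<in> sets M"
    using measurable_orbit_emeasure[OF U] by measurable
  then have P: "P \<in> sets borel" by (simp add: P_def sets_M)
  have P_inv: "act h x \<in> P \<longleftrightarrow> x \<in> P" if "h \<in> K" for h x
    using right_invariant[OF sets_act(2)[OF U] that, of x] by (simp add: P_def act_add)
  have [measurable]: "P \<in> sets M" "- P \<in> sets M" using P sets_M by auto
  note [measurable] = measurable_orbit_emeasure[OF A] measurable_orbit_emeasure[OF U]
    measurable_orbit_emeasure[OF borel_comp[OF U], simplified]
  have U_integral: "emeasure M U = (\<integral>\<^sup>+x. emeasure \<mu> {g. act g x \<in> U} \<partial>M)"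
    using emeasure_inter_invariant[OF U, of UNIV] by simp
  \<comment> \<open>Off \<open>P\<close> only the second alternative of \<open>expansion\<close>
    remains, and it integrates to this bound.\<close>
  have outside: "ennreal L * emeasure M (A \<inter> - P) \<le> emeasure M U"
  proof -
    have "ennreal L * emeasure M (A \<inter> - P) =
        (\<integral>\<^sup>+x. ennreal L * (emeasure \<mu> {g. act g x \<in> A} * indicator (- P) x) \<partial>M)"
      by (subst emeasure_inter_invariant[OF A]) (use P P_inv in \<open>auto simp: nn_integral_cmult\<close>)
    also have "\<dots> \<le> (\<integral>\<^sup>+x. emeasure \<mu> {g. act g x \<in> U} \<partial>M)"
    proof (rule nn_integral_mono)
      fix x
      show "ennreal L * (emeasure \<mu> {g. act g x \<in> A} * indicator (- P) x)
          \<le> emeasure \<mu> {g. act g x \<in> U}"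
        using expansion[of x] L
        by (auto simp: P_iff indicator_def emeasure_eq_measure ennreal_mult'[symmetric])
    qed
    finally show ?thesis by (simp add: U_integral)
  qed
  \<comment> \<open>On \<open>P\<close> an orbit spends at most \<open>1 / L\<close> of its time
    outside \<open>U\<close>. Multiplied by \<open>L\<close> this is at most 1, hence at most
    \<open>2 * (1 - 1 / L)\<close> since \<open>2 \<le> L\<close>, hence at most twice the time
    spent in \<open>U\<close>.\<close>
  have inside: "ennreal L * emeasure M (- U \<inter> P) \<le> 2 * emeasure M U"
  proof -
    have "ennreal L * emeasure M (- U \<inter> P) =
        (\<integral>\<^sup>+x. ennreal L * (emeasure \<mu> {g. act g x \<in> - U} * indicator P x) \<partial>M)"
      by (subst emeasure_inter_invariant) (use U P P_inv in \<open>auto simp: nn_integral_cmult\<close>)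
    also have "\<dots> \<le> (\<integral>\<^sup>+x. 2 * emeasure \<mu> {g. act g x \<in> U} \<partial>M)"
    proof (rule nn_integral_mono)
      fix x
      show "ennreal L * (emeasure \<mu> {g. act g x \<in> - U} * indicator P x)
          \<le> 2 * emeasure \<mu> {g. act g x \<in> U}"
      proof (cases "x \<in> P")
        case True
        have "prob {g. act g x \<in> - U} = 1 - prob {g. act g x \<in> U}"
          using prob_compl[of "{g. act g x \<in> U}"] sets_act(2)[OF U] sets_mu
          by (simp add: Collect_neg_eq Compl_eq_Diff_UNIV)
        then have "L * prob {g. act g x \<in> - U} \<le> L * (1 / L)"
          using True L by (intro mult_left_mono) (auto simp: P_iff)
        also have "\<dots> \<le> 2 * (1 - 1 / L)" using L by (simp add: field_simps)
        also have "\<dots> \<le> 2 * prob {g. act g x \<in> U}" using True by (simp add: P_iff)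
        finally show ?thesis
          using L True
          by (simp add: emeasure_eq_measure ennreal_mult'[symmetric]
              flip: ennreal_numeral)
      qed simp
    qed
    finally show ?thesis by (simp add: U_integral nn_integral_cmult)
  qed
  have sets: "{x. act k x \<in> A \<inter> - P} \<in> sets M" "- U \<inter> P \<in> sets M"
    using A U P sets_act(1)[of "A \<inter> - P" k] by (auto simp: sets_M)
  \<comment> \<open>If \<open>act k x\<close> is in \<open>P\<close>, then so is \<open>x\<close> by
    invariance, and \<open>x\<close> belongs to the part of \<open>P\<close> outside
    \<open>U\<close>.\<close>
  have "{x. act k x \<in> A \<and> x \<notin> U} \<subseteq> {x. act k x \<in> A \<inter> - P} \<union> (- U \<inter> P)"
    using P_inv[OF k] by auto
  then have "emeasure M {x. act k x \<in> A \<and> x \<notin> U}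
      \<le> emeasure M ({x. act k x \<in> A \<inter> - P} \<union> (- U \<inter> P))"
    using sets by (intro emeasure_mono sets.Un)
  also have "\<dots> \<le> emeasure M {x. act k x \<in> A \<inter> - P} + emeasure M (- U \<inter> P)"
    using sets by (rule emeasure_subadditive)
  also have "emeasure M {x. act k x \<in> A \<inter> - P} = emeasure M (A \<inter> - P)"
    using A P by (intro emeasure_act) auto
  finally have "ennreal L * emeasure M {x. act k x \<in> A \<and> x \<notin> U}
      \<le> ennreal L * emeasure M (A \<inter> - P) + ennreal L * emeasure M (- U \<inter> P)"
    by (simp add: mult_left_mono flip: distrib_left)
  also have "\<dots> \<le> emeasure M U + 2 * emeasure M U"
    by (intro add_mono outside inside)
  also have "\<dots> = 3 * emeasure M U"
    using distrib_right[of 1 2 "emeasure M U"] by simp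
  finally show ?thesis .
qed

end


section \<open>From Levy families to expansion along orbits\<close>

text \<open>The definition speaks of one sequence of sets at a time. If uniformity failed,
  counterexamples for infinitely many indices could be assembled into a single sequence violating
  it.\<close>

lemma levy_family_uniform:
  assumes levy: "levy_family X d m" and c: "0 < c" and \<eta>: "0 < \<eta>" and \<epsilon>: "0 < \<epsilon>"
  shows "\<forall>\<^sub>F n in sequentially. \<forall>S\<in>sets (m n). c \<le> measure (m n) S \<longrightarrow>
           1 - \<eta> \<le> measure (m n) (metric_nhd (X n) (d n) S \<epsilon>)"
proof (rule ccontr)
  define bad where "bad n S \<longleftrightarrow> S \<in> sets (m n) \<and> c \<le> measure (m n) S \<and>
      measure (m n) (metric_nhd (X n) (d n) S \<epsilon>) < 1 - \<eta>" for n S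
  have good_iff: "(\<forall>S\<in>sets (m n). c \<le> measure (m n) S \<longrightarrow>
      1 - \<eta> \<le> measure (m n) (metric_nhd (X n) (d n) S \<epsilon>)) \<longleftrightarrow> \<not> (\<exists>S. bad n S)" for n
    by (auto simp: bad_def not_less)
  assume "\<not> ?thesis"
  then have freq: "\<exists>\<^sub>F n in sequentially. \<exists>S. bad n S"
    unfolding frequently_def good_iff .
  define A where "A n = (if \<exists>S. bad n S then SOME S. bad n S else X n)" for n
  have A_bad: "bad n (A n)" if "\<exists>S. bad n S" for n
    using that someI_ex[OF that] by (simp add: A_def)
  have space: "space (m n) = X n" and one: "emeasure (m n) (X n) = 1" for n
    using levy by (auto simp: levy_family_def)
  have A_sets: "A n \<in> sets (m n)" for n
  proof (cases "\<exists>S. bad n S")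
    case True
    then show ?thesis using A_bad by (simp add: bad_def)
  next
    case False
    then show ?thesis using sets.top[of "m n"] by (simp add: A_def space)
  qed
  \<comment> \<open>The minimum with 1 covers those filler indices, as \<open>c\<close> may exceed
    1.\<close>
  have A_ge: "ennreal (min c 1) \<le> emeasure (m n) (A n)" for n
  proof (cases "\<exists>S. bad n S")
    case True
    interpret prob_space "m n" by standard (simp add: space one)
    have "min c 1 \<le> measure (m n) (A n)"
      using A_bad[OF True] unfolding bad_def by (blast intro: min.coboundedI1)
    then show ?thesis unfolding emeasure_eq_measure by (rule ennreal_leI)
  next
    case False
    then show ?thesis using one by (simp add: A_def)
  qed
  have "ennreal (min c 1) \<le> liminf (\<lambda>n. emeasure (m n) (A n))"
    by (intro Liminf_bounded always_eventually allI A_ge)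
  moreover have "0 < ennreal (min c 1)" using c by simp
  ultimately have "0 < liminf (\<lambda>n. emeasure (m n) (A n))" by (rule less_le_trans[rotated])
  with levy A_sets \<epsilon> have "(\<lambda>n. emeasure (m n) (metric_nhd (X n) (d n) (A n) \<epsilon>)) \<longlonglongrightarrow> 1"
    unfolding levy_family_def by blast
  then have "(\<lambda>n. measure (m n) (metric_nhd (X n) (d n) (A n) \<epsilon>)) \<longlonglongrightarrow> 1"
    unfolding measure_def using tendsto_enn2real[where l = 1] by fastforce
  then have "\<forall>\<^sub>F n in sequentially. 1 - \<eta> < measure (m n) (metric_nhd (X n) (d n) (A n) \<epsilon>)"
    using \<eta> by (intro order_tendstoD) auto
  with freq have "\<exists>\<^sub>F n in sequentially. (\<exists>S. bad n S) \<and>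
      1 - \<eta> < measure (m n) (metric_nhd (X n) (d n) (A n) \<epsilon>)"
    by (rule frequently_eventually_frequently)
  from frequently_ex[OF this] obtain n where "\<exists>S. bad n S"
      "1 - \<eta> < measure (m n) (metric_nhd (X n) (d n) (A n) \<epsilon>)"
    by blast
  with A_bad[of n] show False by (simp add: bad_def)
qed

lemma haar_prob_extend:
  fixes K :: "'g::{topological_group_add, second_countable_topology} set"
  assumes haar: "normalized_haar_measure K m" and K: "K \<in> sets borel" "subgroup_add K"
  shows "haar_prob (distr m borel id) K"
    and "B \<in> sets borel \<Longrightarrow> measure (distr m borel id) B = measure m (B \<inter> K)"
proof -
  have space: "space m = K" and sets: "sets m = sets (restrict_space borel K)"
    and one: "emeasure m K = 1"
    and inv: "\<And>g A. g \<in> K \<Longrightarrow> A \<in> sets m \<Longrightarrow> emeasure m ((\<lambda>k. g + k) ` A) = emeasure m A"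
    using haar by (auto simp: normalized_haar_measure_def)
  have "id \<in> measurable (restrict_space borel K) borel"
    by (intro measurable_restrict_space1) simp
  then have id: "id \<in> measurable m borel"
    using measurable_cong_sets[OF sets refl] by blast
  have em: "emeasure (distr m borel id) B = emeasure m (B \<inter> K)" if "B \<in> sets borel" for B
    using that by (subst emeasure_distr[OF id]) (auto simp: space)
  then show "measure (distr m borel id) B = measure m (B \<inter> K)" if "B \<in> sets borel"
    using that by (simp add: measure_def)
  have m: "prob_space m" by (rule prob_spaceI) (simp add: space one)
  show "haar_prob (distr m borel id) K"
  proof (intro haar_prob.intro haar_prob_axioms.intro)
    show "prob_space (distr m borel id)" by (rule prob_space.prob_space_distr[OF m id])
    have "emeasure (distr m borel id) (- K) = 0" using em[of "- K"] K by simp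
    then show "AE g in distr m borel id. g \<in> K"
      using K by (intro AE_I[of _ _ "- K"]) auto
    fix g B assume g: "g \<in> K" and B: "B \<in> sets (borel :: 'g measure)"
    have ng: "- g \<in> K" using subgroup_add_minus[OF K(2) g] by simp
    \<comment> \<open>Haar invariance is stated for images and the locale uses preimages; the
      preimage under translation by \<open>g\<close> is the image under translation by
      \<open>- g\<close>.\<close>
    have "(\<lambda>k. - g + k) ` (B \<inter> K) = {h. g + h \<in> B} \<inter> K"
    proof (intro set_eqI iffI)
      fix h assume "h \<in> {h. g + h \<in> B} \<inter> K"
      then have "h = - g + (g + h)" "g + h \<in> B \<inter> K"
        using g K(2) by (auto simp: subgroup_add_def add.assoc[symmetric])
      then show "h \<in> (\<lambda>k. - g + k) ` (B \<inter> K)" by blast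
    qed (use ng K(2) in \<open>auto simp: subgroup_add_def add.assoc[symmetric]\<close>)
    moreover have "B \<inter> K \<in> sets m"
      using B sets by (auto simp: sets_restrict_space)
    moreover have "{h. g + h \<in> B} \<in> sets borel"
      by (intro sets_borel_Collect_continuous continuous_intros B)
    ultimately show "emeasure (distr m borel id) {h. g + h \<in> B} = emeasure (distr m borel id) B"
      using inv[OF ng, of "B \<inter> K"] em B by simp
  qed (auto simp: K)
qed

lemma eventually_orbit_expansion:
  fixes K :: "nat \<Rightarrow> 'g::{topological_group_add, second_countable_topology} set"
  assumes levy: "levy_family K (\<lambda>_. d) m"
    and haar: "\<And>n. normalized_haar_measure (K n) (m n)"
    and K: "\<And>n. K n \<in> sets borel" "\<And>n. subgroup_add (K n)"
    and d: "\<And>g h k. d (g + k) (h + k) = d g h"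
    and L: "3 \<le> L" and \<epsilon>: "0 < \<epsilon>"
  shows "\<forall>\<^sub>F n in sequentially. \<forall>S\<in>sets borel. \<forall>S'\<in>sets borel.
      (\<forall>g\<in>K n. \<forall>h\<in>K n. h \<in> S \<longrightarrow> d g h < \<epsilon> \<longrightarrow> g \<in> S') \<longrightarrow>
      1 - 1 / L \<le> measure (distr (m n) borel id) S' \<or>
      L * measure (distr (m n) borel id) S \<le> measure (distr (m n) borel id) S'"
proof -
  \<comment> \<open>These are the two thresholds in the concentration hypothesis of
    \<open>neighborhood_expansion\<close>.\<close>
  have "\<forall>\<^sub>F n in sequentially. \<forall>S\<in>sets (m n). 1 / (8 * L) \<le> measure (m n) S \<longrightarrow>
      1 - 1 / L \<le> measure (m n) (metric_nhd (K n) d S \<epsilon>)"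
    using L \<epsilon> by (intro levy_family_uniform[OF levy]) auto
  then show ?thesis
  proof eventually_elim
    case (elim n)
    interpret haar_prob "distr (m n) borel id" "K n"
      by (rule haar_prob_extend[OF haar K])
    note prob_eq = haar_prob_extend(2)[OF haar K]
    have sets: "sets (m n) = sets (restrict_space borel (K n))"
      using haar by (auto simp: normalized_haar_measure_def)
    have fin: "finite_measure (m n)"
      using haar[of n] by (intro finite_measureI) (auto simp: normalized_haar_measure_def)
    have "1 - 1 / L \<le> prob S'"
      if S: "S \<in> sets borel" "S' \<in> sets borel" "1 / (8 * L) \<le> prob S"
        and nhd: "\<And>g h. g \<in> K n \<Longrightarrow> h \<in> K n \<Longrightarrow> h \<in> S \<Longrightarrow> d g h < \<epsilon> \<Longrightarrow> g \<in> S'" for S S'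
    proof -
      have "S \<inter> K n \<in> sets (m n)" "S' \<inter> K n \<in> sets (m n)"
        using S by (auto simp: sets sets_restrict_space)
      moreover have "metric_nhd (K n) d (S \<inter> K n) \<epsilon> \<subseteq> S' \<inter> K n"
        using nhd by (auto simp: metric_nhd_def INF_less_iff)
      ultimately have "measure (m n) (metric_nhd (K n) d (S \<inter> K n) \<epsilon>) \<le> prob S'"
        using S by (auto simp: prob_eq intro!: finite_measure.finite_measure_mono[OF fin])
      moreover have "1 - 1 / L \<le> measure (m n) (metric_nhd (K n) d (S \<inter> K n) \<epsilon>)"
        using elim \<open>S \<inter> K n \<in> sets (m n)\<close> S by (simp add: prob_eq)
      ultimately show ?thesis by simp
    qed
    then show ?case
      using d L by (intro ballI impI neighborhood_expansion[of "\<lambda>g h. d g h < \<epsilon>" L]) simp_all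
  qed
qed

section \<open>Exhausting an open set by uniform cores\<close>

text \<open>Requiring only \<open>act v x \<in> U\<close> for all small \<open>v\<close> would give
  an uncountable intersection of open sets. The extra margin \<open>y\<close> makes the complement a
  union of open sets, so the core is closed and thus Borel.\<close>

definition uniform_core :: "('g::topological_group_add \<Rightarrow> 'g \<Rightarrow> real) \<Rightarrow>
    ('g \<Rightarrow> 'x \<Rightarrow> 'x::metric_space) \<Rightarrow> 'x set \<Rightarrow> real \<Rightarrow> 'x set" where
  "uniform_core d act U r =
     {x. \<forall>v y. d v 0 < r \<longrightarrow> dist (act v x) y < r \<longrightarrow> y \<in> U}"

lemma closed_uniform_core:
  assumes "\<And>v. continuous_on UNIV (act v)"
  shows "closed (uniform_core d act U r)"
proof -
  have "open {x. dist (act v x) y < r}" for v y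
    using assms[of v] by (intro open_Collect_less continuous_intros) auto
  moreover have "- uniform_core d act U r = (\<Union>v\<in>{v. d v 0 < r}. \<Union>y\<in>- U. {x. dist (act v x) y < r})"
    by (auto simp: uniform_core_def)
  ultimately show ?thesis
    by (simp add: closed_def open_UN)
qed

lemma mem_uniform_core:
  assumes d: "right_invariant_compatible_metric d" and "open U" "x \<in> U"
    and cont: "continuous_on UNIV (\<lambda>v. act v x)" and act_0: "act 0 x = x"
  shows "\<exists>j. x \<in> uniform_core d act U (1 / real (Suc j))"
proof -
  interpret Metric_space UNIV d
    using d by (simp add: right_invariant_compatible_metric_def)
  have top: "mtopology = euclidean"
    using d by (simp add: right_invariant_compatible_metric_def)
  obtain e where e: "0 < e" "ball x e \<subseteq> U"
    using assms(2,3) open_contains_ball by blast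
  have "open {v. dist (act v x) x < e / 2}"
    using cont by (intro open_Collect_less continuous_intros) auto
  then have "openin mtopology {v. dist (act v x) x < e / 2}" by (simp add: top)
  moreover have "0 \<in> {v. dist (act v x) x < e / 2}" using e act_0 by simp
  ultimately obtain s where s: "0 < s" "mball 0 s \<subseteq> {v. dist (act v x) x < e / 2}"
    unfolding openin_mtopology by blast
  \<comment> \<open>One bound serves both purposes: below \<open>s\<close> it keeps
    \<open>act v x\<close> within \<open>e / 2\<close> of \<open>x\<close>, and below
    \<open>e / 2\<close> it keeps \<open>y\<close> that close to \<open>act v x\<close>.\<close>
  obtain j where j: "1 / real (Suc j) < min s (e / 2)"
    using nat_approx_posE[of "min s (e / 2)"] s e by auto
  have "y \<in> U" if "d v 0 < 1 / real (Suc j)" "dist (act v x) y < 1 / real (Suc j)" for v y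
  proof -
    have "v \<in> mball 0 s" using that j by (simp add: commute)
    then have "dist (act v x) x < e / 2" using s by blast
    then have "dist x y < e"
      using that(2) j dist_triangle[of x y "act v x"] by (simp add: dist_commute)
    then show ?thesis using e by auto
  qed
  then show ?thesis by (auto simp: uniform_core_def)
qed


section \<open>Null displacement and the fixed points\<close>

text \<open>Separability alone gives a countable dense set somewhere in the group; here it has to
  lie inside the union of the compact subgroups, where displacement is controlled.\<close>

lemma countable_dense_subset:
  fixes S :: "'a::second_countable_topology set"
  assumes "closure S = UNIV"
  obtains D where "countable D" "D \<subseteq> S" "closure D = UNIV"
proof -
  obtain B :: "'a set set" where B: "countable B" "topological_basis B"
    using ex_countable_basis by metis
  define D where "D = (\<lambda>b. SOME x. x \<in> b \<inter> S) ` {b\<in>B. b \<inter> S \<noteq> {}}"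
  have choice: "(SOME x. x \<in> b \<inter> S) \<in> b \<inter> S" if "b \<inter> S \<noteq> {}" for b
    using that by (simp only: some_in_eq not_False_eq_True)
  have "x \<in> closure D" for x
    unfolding closure_iff_nhds_not_empty
  proof (intro allI impI)
    fix A V assume V: "V \<subseteq> A" "open V" "x \<in> V"
    obtain b where b: "b \<in> B" "x \<in> b" "b \<subseteq> V"
      using topological_basisE[OF B(2) V(2,3)] by metis
    then have "b \<inter> S \<noteq> {}"
      using assms topological_basis_open[OF B(2)] open_Int_closure_eq_empty[of b S] by auto
    then show "D \<inter> A \<noteq> {}"
      using choice[of b] b V unfolding D_def by blast
  qed
  moreover have "D \<subseteq> S" using choice by (auto simp: D_def)
  moreover have "countable D" using B by (simp add: D_def)
  ultimately show thesis using that by blast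
qed

text \<open>For a fixed core, the displaced measure times \<open>L\<close> is at most
  \<open>3 * emeasure M U\<close> for every \<open>L \<ge> 3\<close>, with \<open>n\<close>
  depending on \<open>L\<close>; hence it vanishes. Countably many cores exhaust
  \<open>U\<close>.\<close>

lemma emeasure_displaced_eq_0:
  fixes M :: "'x::polish_space measure"
    and act :: "'g::{topological_group_add, second_countable_topology} \<Rightarrow> 'x \<Rightarrow> 'x"
  assumes levy: "levy_family K (\<lambda>_. d) m"
    and haar: "\<And>n. normalized_haar_measure (K n) (m n)"
    and K: "\<And>n. K n \<in> sets borel" "\<And>n. subgroup_add (K n)" and "incseq K"
    and d: "right_invariant_compatible_metric d"
    and M: "sets M = sets borel" "sigma_finite_measure M"
    and act: "continuous_measure_preserving_action M act"
    and k: "k \<in> (\<Union>n. K n)" and U: "open U" "emeasure M U < \<infinity>"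
  shows "{x. act k x \<in> U \<and> x \<notin> U} \<in> null_sets M"
proof -
  have d_inv: "d (g + k) (h + k) = d g h" for g h k
    using d by (simp add: right_invariant_compatible_metric_def)
  have act_0: "act 0 x = x" and act_add: "act (g + h) x = act g (act h x)" for g h x
    using act by (auto simp: continuous_measure_preserving_action_def group_action_add_def)
  note cont1 = continuous_action(2)[OF act] and cont2 = continuous_action(3)[OF act]
  have U_borel: "U \<in> sets borel" using U by simp
  define C where "C r = uniform_core d act U r" for r
  have C: "C r \<in> sets borel" for r
    unfolding C_def by (intro borel_closed closed_uniform_core cont1)
  obtain n0 where n0: "k \<in> K n0" using k by blast
  have null: "{x. act k x \<in> C r \<and> x \<notin> U} \<in> null_sets M" if r: "0 < r" for r
  proof -
    let ?e = "emeasure M {x. act k x \<in> C r \<and> x \<notin> U}"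
    have le: "ennreal L * ?e \<le> 3 * emeasure M U" if L: "3 \<le> L" for L
    proof -
      obtain n where n: "k \<in> K n" and expansion: "\<forall>S\<in>sets borel. \<forall>S'\<in>sets borel.
          (\<forall>g\<in>K n. \<forall>h\<in>K n. h \<in> S \<longrightarrow> d g h < r \<longrightarrow> g \<in> S') \<longrightarrow>
          1 - 1 / L \<le> measure (distr (m n) borel id) S' \<or>
          L * measure (distr (m n) borel id) S \<le> measure (distr (m n) borel id) S'"
      proof -
        have "\<forall>\<^sub>F n in sequentially. k \<in> K n"
          using n0 \<open>incseq K\<close> by (auto simp: eventually_sequentially incseq_def)
        from eventually_happens[OF eventually_conj[OF this
            eventually_orbit_expansion[OF levy haar K d_inv L r]]] that
        show thesis by force
      qed
      interpret haar_action "distr (m n) borel id" "K n" M act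
        by (intro haar_action.intro haar_action_axioms.intro haar_prob_extend(1) haar K M act)
      show ?thesis
      proof (rule emeasure_displaced_le[OF C U_borel _ n])
        fix x
        \<comment> \<open>Write \<open>g\<close> as \<open>(g - h) + h\<close>. By right-invariance
          \<open>g - h\<close> is close to 0, so it cannot move a point of the core out of
          \<open>U\<close>.\<close>
        have "act g x \<in> U" if "act h x \<in> C r" "d g h < r" for g h
        proof -
          have "d (g - h) 0 < r" using d_inv[of g "- h" h] that(2) by simp
          moreover have "act (g - h) (act h x) = act g x"
            by (simp flip: act_add)
          ultimately show ?thesis
            using that(1) r by (auto simp: C_def uniform_core_def)
        qed
        then show "1 - 1 / L \<le> prob {g. act g x \<in> U} \<or>
            L * prob {g. act g x \<in> C r} \<le> prob {g. act g x \<in> U}"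
          using expansion sets_act(2)[OF C] sets_act(2)[OF U_borel] by auto
      qed (use L in simp)
    qed
    have "?e = 0"
    proof (rule ccontr)
      assume "?e \<noteq> 0"
      obtain u where u: "emeasure M U = ennreal u" "0 \<le> u"
        using U(2) by (cases "emeasure M U") auto
      have "?e < \<infinity>"
        using le[of 3] U(2) by (cases ?e) (auto simp: ennreal_mult_top ennreal_mult_eq_top_iff top_unique)
      then obtain e where e: "?e = ennreal e" "0 < e"
        using \<open>?e \<noteq> 0\<close> by (cases ?e) (auto simp: less_le)
      have *: "L * e \<le> 3 * u" if "3 \<le> L" for L
        using le[OF that] that u e(2) unfolding e(1) u(1)
        by (simp add: ennreal_mult'[symmetric] flip: ennreal_numeral)
      \<comment> \<open>This value of \<open>L\<close> exceeds \<open>3 * u / e\<close>, the largest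
        one compatible with the bound.\<close>
      have "(3 + 3 * u / e) * e \<le> 3 * u" using u e by (intro *) simp
      moreover have "(3 + 3 * u / e) * e = 3 * e + 3 * u" using e by (simp add: field_simps)
      ultimately show False using e by simp
    qed
    moreover have "{x. act k x \<in> C r \<and> x \<notin> U} \<in> sets borel"
      using sets_borel_Collect_continuous[OF cont1 C, of k r] U_borel
      by (simp add: Collect_conj_eq Collect_neg_eq)
    ultimately show ?thesis using M by (intro null_setsI) auto
  qed
  have "{x. act k x \<in> U \<and> x \<notin> U} = (\<Union>j. {x. act k x \<in> C (1 / real (Suc j)) \<and> x \<notin> U})"
  proof -
    have "y \<in> U \<longleftrightarrow> (\<exists>j. y \<in> C (1 / real (Suc j)))" for y
    proof
      show "\<exists>j. y \<in> C (1 / real (Suc j))" if "y \<in> U"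
        unfolding C_def by (intro mem_uniform_core d U(1) that cont2 act_0)
      show "y \<in> U" if ex: "\<exists>j. y \<in> C (1 / real (Suc j))"
      proof -
        obtain j where "y \<in> C (1 / real (Suc j))" using ex by blast
        \<comment> \<open>The core lies in \<open>U\<close>: take the identity for \<open>v\<close>
          and the point itself for \<open>y\<close>.\<close>
        then have "d 0 0 < 1 / real (Suc j) \<longrightarrow> dist (act 0 y) y < 1 / real (Suc j) \<longrightarrow> y \<in> U"
          unfolding C_def uniform_core_def by blast
        moreover have "d 0 0 = 0"
          using d Metric_space.zero[of UNIV d 0 0]
          by (simp add: right_invariant_compatible_metric_def)
        ultimately show ?thesis by (simp add: act_0)
      qed
    qed
    then show ?thesis by blast
  qed
  also have "\<dots> \<in> null_sets M"
    by (intro null_sets_UN null) simp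
  finally show ?thesis .
qed

theorem theorem5:
  fixes M :: "'x::polish_space measure"
    and act :: "'g::{topological_group_add, polish_space} \<Rightarrow> 'x \<Rightarrow> 'x"
  assumes "levy_group TYPE('g)"
    and "sets M = sets borel"
    and "sigma_finite_measure M"
    and "atomless M"
    and "locally_finite_measure M"
    and "continuous_measure_preserving_action M act"
  shows "space M - fixed_points act \<in> null_sets M"
proof -
  obtain K :: "nat \<Rightarrow> 'g set" and m d where inc: "incseq K"
    and K: "\<And>n. compact (K n)" "\<And>n. subgroup_add (K n)"
    and dense: "closure (\<Union>n. K n) = UNIV"
    and haar: "\<And>n. normalized_haar_measure (K n) (m n)"
    and d: "right_invariant_compatible_metric d" and levy: "levy_family K (\<lambda>_. d) m"
    using assms(1) unfolding levy_group_def by blast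
  have K_borel: "K n \<in> sets borel" for n
    using compact_imp_closed[OF K(1)] by simp
  note cont1 = continuous_action(2)[OF assms(6)] and cont2 = continuous_action(3)[OF assms(6)]
  obtain D where D: "countable D" "D \<subseteq> (\<Union>n. K n)" "closure D = UNIV"
    using countable_dense_subset[OF dense] .
  obtain B :: "'x set set" where B: "countable B" "topological_basis B"
    using ex_countable_basis by metis
  \<comment> \<open>Local finiteness ensures that these basic sets still form arbitrarily small
    neighborhoods of every point.\<close>
  define B' where "B' = {U\<in>B. emeasure M U < \<infinity>}"
  define N where "N = (\<Union>k\<in>D. \<Union>U\<in>B'. {x. act k x \<in> U \<and> x \<notin> U})"
  have "countable B'" using B by (simp add: B'_def)
  moreover have "{x. act k x \<in> U \<and> x \<notin> U} \<in> null_sets M" if "k \<in> D" "U \<in> B'" for k U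
    using that D(2) topological_basis_open[OF B(2)]
    by (intro emeasure_displaced_eq_0[OF levy haar K_borel K(2) inc d assms(2,3,6)])
      (auto simp: B'_def)
  ultimately have N: "N \<in> null_sets M"
    unfolding N_def by (intro null_sets_UN' D(1)) auto
  \<comment> \<open>If \<open>k\<close> moves \<open>x\<close>, some member of \<open>B'\<close>
    contains \<open>act k x\<close> but not \<open>x\<close>, which puts \<open>x\<close> into
    \<open>N\<close>.\<close>
  have fixed_D: "act k x = x" if "x \<notin> N" "k \<in> D" for k x
  proof (rule ccontr)
    assume "act k x \<noteq> x"
    then obtain V where V: "open V" "act k x \<in> V" "x \<notin> V"
      using t1_space by blast
    obtain W where W: "open W" "act k x \<in> W" "emeasure M W < \<infinity>"
      using assms(5) unfolding locally_finite_measure_def by blast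
    obtain U where U: "U \<in> B" "act k x \<in> U" "U \<subseteq> V \<inter> W"
      using topological_basisE[OF B(2), of "V \<inter> W" "act k x"] V W by blast
    have "emeasure M U \<le> emeasure M W"
      using U W assms(2) by (intro emeasure_mono) auto
    then have "U \<in> B'" using U W by (auto simp: B'_def)
    then show False using that U V by (auto simp: N_def)
  qed
  have fixed: "act g x = x" if "x \<notin> N" for g x
  proof -
    have "closed {g. act g x = x}"
      by (intro closed_Collect_eq cont2 continuous_intros)
    then have "closure D \<subseteq> {g. act g x = x}"
      using fixed_D[OF that] by (intro closure_minimal) auto
    then show ?thesis using D(3) by auto
  qed
  \<comment> \<open>Closedness supplies measurability, since \<open>M\<close> is not assumed
    complete and inclusion in \<open>N\<close> alone would not suffice.\<close>
  have "fixed_points act = (\<Inter>g. {x. act g x = x})"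
    by (auto simp: fixed_points_def)
  moreover have "closed {x. act g x = x}" for g
    by (intro closed_Collect_eq cont1 continuous_intros)
  ultimately have "closed (fixed_points act)" by auto
  then have "space M - fixed_points act \<in> sets M"
    by (intro sets.compl_sets) (simp add: assms(2))
  moreover have "space M - fixed_points act \<subseteq> N"
    using fixed by (auto simp: fixed_points_def)
  ultimately show ?thesis by (rule null_sets_subset[OF N])
qed

end
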